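(* Let $p$ be an odd prime, let $m>1$ be an odd integer, let $q=p^m$, and let $D=\{x\in \mathrm{GF}(q)^*: \mathrm{Tr}(x^2)=0\}$. Let $\bar D=\{d_1,\ldots,d_n\}\subseteq D$ be such that $D=\{ab: a\in \mathrm{GF}(p)^*,\ b\in\bar D\}$ and $d_i/d_j\notin \mathrm{GF}(p)^*$ for every pair of distinct elements $d_i,d_j$ of $\bar D$. Then $$\mathcal{C}_{\bar D}=\{(\mathrm{Tr}(xd_1),\ldots,\mathrm{Tr}(xd_n)): x\in \mathrm{GF}(q)\}$$ is a linear code over $\mathrm{GF}(p)$ of length $n=(p^{m-1}-1)/(p-1)$ and dimension $m$, and its weight distribution is - $A_0=1$; - $A_w=\frac{p-1}{2}\left(p^{m-1}+p^{\frac{m-1}{2}}\right)$ for $w=p^{m-2}-p^{\frac{m-3}{2}}$; - $A_w=p^{m-1}-1$ for $w=p^{m-2}$; - $A_w=\frac{p-1}{2}\left(p^{m-1}-p^{\frac{m-1}{2}}\right)$ for $w=p^{m-2}+p^{\frac{m-3}{2}}$; and $A_w=0$ for all other weights $w$.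
   Context: $\mathrm{GF}(q)$ is the finite field with $q$ elements, $\mathrm{GF}(q)^*$ its multiplicative group, and $\mathrm{Tr}$ is the trace function from $\mathrm{GF}(q)$ onto $\mathrm{GF}(p)$. The set $D$ is closed under multiplication by $\mathrm{GF}(p)^*$, and $\bar D$ is a set of representatives of $D$ modulo this action, with elements listed in any fixed order. A linear code of length $n$ and dimension $k$ over $\mathrm{GF}(p)$ is a $k$-dimensional subspace of $\mathrm{GF}(p)^n$; $A_w$ denotes the number of codewords of Hamming weight $w$ in the code. *)

theory Defs
  imports
    "Jordan_Normal_Form.VS_Connect"
    "Berlekamp_Zassenhaus.Finite_Field"
begin

text \<open>
  \<open>GF(q)\<close> is a type \<open>'q\<close> of class \<open>finite_field\<close>, and \<open>GF(p)\<close> is the ring of integers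
  modulo its characteristic. Inside \<open>GF(q)\<close>, the field \<open>GF(p)\<close> appears as the prime subfield,
  i.e. as the image of the unique ring homomorphism \<open>of_gfp\<close>.
\<close>

type_synonym 'q gfp = "'q ring_char mod_ring"

definition of_gfp :: "'q gfp \<Rightarrow> 'q :: finite_field" where
  "of_gfp a = of_int (to_int_mod_ring a)"

text \<open>
  The trace \<open>x + x^p + \<dots> + x^(p^(m-1))\<close> of \<open>GF(p^m)\<close> over \<open>GF(p)\<close>. The sum of conjugates is
  formed in \<open>GF(q)\<close>, lies in the prime subfield, and is read there as an element of \<open>GF(p)\<close>
  (see \<open>of_gfp_tr\<close> below). The argument \<open>m\<close> has to be the degree of the extension.
\<close>

definition tr :: "nat \<Rightarrow> 'q :: finite_field \<Rightarrow> 'q gfp" where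
  "tr m x = the_inv of_gfp (\<Sum>i<m. x ^ (CHAR('q) ^ i))"

definition linear_code :: "nat \<Rightarrow> nat \<Rightarrow> 'f :: field vec set \<Rightarrow> bool" where
  "linear_code n k C \<longleftrightarrow>
     VectorSpace.subspace class_ring C (module_vec TYPE('f) n) \<and>
     vectorspace.dim class_ring ((module_vec TYPE('f) n)\<lparr>carrier := C\<rparr>) = k"

definition hamming_weight :: "'f :: zero vec \<Rightarrow> nat" where
  "hamming_weight v = card {i. i < dim_vec v \<and> v $ i \<noteq> 0}"

definition num_codewords :: "'f :: zero vec set \<Rightarrow> nat \<Rightarrow> nat" where
  "num_codewords C w = card {c \<in> C. hamming_weight c = w}"

definition trace_code :: "nat \<Rightarrow> 'q :: finite_field list \<Rightarrow> 'q gfp vec set" where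
  "trace_code m ds = {vec_of_list (map (\<lambda>d. tr m (x * d)) ds) | x. x \<in> UNIV}"


lemma of_gfp_add: "of_gfp (a + b) = of_gfp a + of_gfp b"
  by (simp add: of_gfp_def to_int_mod_ring_add)

lemma of_gfp_mult: "of_gfp (a * b) = of_gfp a * of_gfp b"
  by (simp add: of_gfp_def to_int_mod_ring_mult)

lemma of_gfp_0: "of_gfp 0 = 0"
  by (simp add: of_gfp_def)

lemma of_gfp_1: "of_gfp 1 = 1"
  by (simp add: of_gfp_def)

lemma inj_of_gfp: "inj (of_gfp :: 'q gfp \<Rightarrow> 'q :: finite_field)"
proof (rule injI)
  fix a b :: "'q gfp"
  assume "of_gfp a = of_gfp b"
  hence "[to_int_mod_ring a = to_int_mod_ring b] (mod int CHAR('q))"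
    by (simp add: of_gfp_def of_int_eq_iff_cong_CHAR)
  moreover have "to_int_mod_ring c \<in> {0..<int CHAR('q)}" for c :: "'q gfp"
    using range_to_int_mod_ring[where 'a = "'q ring_char"] by auto
  ultimately have "to_int_mod_ring a = to_int_mod_ring b"
    unfolding cong_def by (metis atLeastLessThan_iff mod_pos_pos_trivial)
  thus "a = b"
    by (metis of_int_mod_ring_to_int_mod_ring)
qed

lemma range_of_gfp: "range of_gfp = {x :: 'q :: finite_field. x ^ CHAR('q) = x}"
proof (rule card_seteq)
  let ?p = "CHAR('q)"
  let ?f = "Polynomial.monom 1 ?p - Polynomial.monom 1 1 :: 'q poly"
  have p: "prime ?p"
    by (rule prime_CHAR_semidom) simp
  hence p1: "?p > 1"
    by (rule prime_gt_1_nat)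
  show "finite {x :: 'q. x ^ ?p = x}"
    by simp
  show "range of_gfp \<subseteq> {x :: 'q. x ^ ?p = x}"
  proof safe
    fix a :: "'q gfp"
    have "a ^ ?p = a"
      using finite_field_power_card_eq_same[of a] by simp
    moreover have "of_gfp (a ^ n) = of_gfp a ^ n" for n
      by (induction n) (simp_all add: of_gfp_1 of_gfp_mult)
    ultimately show "of_gfp a ^ ?p = of_gfp a"
      by metis
  qed
  have "Polynomial.coeff ?f ?p = 1"
    using p1 by simp
  hence nz: "?f \<noteq> 0"
    by (metis Polynomial.coeff_0 zero_neq_one)
  have "Polynomial.degree ?f \<le> ?p"
    using p1 by (intro degree_diff_le order.trans[OF degree_monom_le]) auto
  moreover have "{x :: 'q. x ^ ?p = x} = {x. poly ?f x = 0}"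
    by (simp add: poly_monom)
  moreover have "card {x. poly ?f x = 0} \<le> Polynomial.degree ?f"
    using nz by (rule card_poly_roots_bound)
  moreover have "card (range (of_gfp :: 'q gfp \<Rightarrow> 'q)) = ?p"
    by (simp add: card_image inj_of_gfp)
  ultimately show "card {x :: 'q. x ^ ?p = x} \<le> card (range (of_gfp :: 'q gfp \<Rightarrow> 'q))"
    by simp
qed

lemma of_gfp_tr:
  fixes x :: "'q :: finite_field"
  assumes "CARD('q) = CHAR('q) ^ m"
  shows "of_gfp (tr m x) = (\<Sum>i<m. x ^ (CHAR('q) ^ i))"
proof -
  let ?p = "CHAR('q)"
  let ?s = "\<Sum>i<m. x ^ (?p ^ i)"
  have p: "prime ?p"
    by (rule prime_CHAR_semidom) simp
  have "x ^ (?p ^ m) = x"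
    using finite_field_power_card_eq_same[of x] assms by simp
  moreover have "?s ^ ?p = (\<Sum>i<m. x ^ (?p ^ Suc i))"
    by (simp add: freshmans_dream_sum[OF p refl] mult.commute flip: power_mult)
  moreover have "x + (\<Sum>i<m. x ^ (?p ^ Suc i)) = (\<Sum>i<Suc m. x ^ (?p ^ i))"
    by (subst sum.lessThan_Suc_shift) simp
  moreover have "(\<Sum>i<Suc m. x ^ (?p ^ i)) = x + ?s"
    using calculation(1) by simp
  ultimately have "?s ^ ?p = ?s"
    by simp
  hence "?s \<in> range of_gfp"
    by (simp add: range_of_gfp)
  thus ?thesis
    unfolding tr_def by (intro f_the_inv_into_f inj_of_gfp)
qed

end

theory Submission
  imports Defs
begin

text \<open>
  Let \<open>Q x = Tr (x\<^sup>2)\<close>, \<open>r = p ^ (m - 1)\<close> and let \<open>N a\<close> count the solutions of \<open>Q x = a\<close>. As \<open>m\<close> is odd,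
  some \<open>u\<close> in \<open>GF(p)\<close> is not a square in \<open>GF(q)\<close>; then \<open>x\<^sup>2\<close> and \<open>u * x\<^sup>2\<close> together cover \<open>GF(q)\<close> twice,
  so \<open>N a + N (a / u) = 2 * r\<close>, and in particular \<open>N 0 = r\<close>. The factorisation of \<open>x\<^sup>2 - y\<^sup>2\<close> gives
  the second moment of \<open>N\<close>, which forces \<open>(N a - r)\<^sup>2 = r\<close> for \<open>a \<noteq> 0\<close>. Finally \<open>p - 1\<close> times the weight of the codeword
  of \<open>x\<close> is the number of isotropic \<open>y\<close> with \<open>Tr (x * y) \<noteq> 0\<close>. Translations along \<open>x\<close> (if
  \<open>Q x = 0\<close>) or stereographic projection from \<open>x\<close> (if \<open>Q x \<noteq> 0\<close>) give
  \<open>p * weight = r\<close> and \<open>p * weight = 2 * r - N (Q x)\<close>.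
\<close>

section \<open>Counting in finite fields\<close>

lemma sum_card_fibers:
  fixes g :: "'a :: finite \<Rightarrow> 'b :: finite"
  shows "(\<Sum>b\<in>UNIV. card {x. P x \<and> g x = b}) = card {x. P x}"
  using sum.group[of "{x. P x}" UNIV g "\<lambda>_. 1 :: nat"] by simp

lemma sum_card_fibers_on:
  fixes g :: "'a :: finite \<Rightarrow> 'b :: finite"
  shows "(\<Sum>b\<in>B. card {x. g x = b}) = card {x. g x \<in> B}"
proof -
  have "(\<Sum>b\<in>B. card {x. g x = b}) = (\<Sum>b\<in>B. card {x \<in> {x. g x \<in> B}. g x = b})"
    by (intro sum.cong arg_cong[of _ _ card]) auto
  also have "\<dots> = card {x. g x \<in> B}"
    using sum.group[of "{x. g x \<in> B}" B g "\<lambda>_. 1 :: nat"] by (simp add: image_subset_iff)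
  finally show ?thesis .
qed

text \<open>Translation by a preimage of \<open>a - b\<close> carries the fibre over
  \<open>b\<close> onto the fibre over \<open>a\<close>, so the fibres partition the domain into
  equal parts.\<close>

lemma card_additive_fiber:
  fixes f :: "'a :: {finite, ab_group_add} \<Rightarrow> 'b :: {finite, ab_group_add}"
  assumes add: "\<And>x y. f (x + y) = f x + f y" and "surj f"
  shows "CARD('b) * card {x. f x = a} = CARD('a)"
proof -
  have eq: "card {x. f x = b} = card {x. f x = a}" for b
  proof -
    obtain z where z: "f z = a - b"
      using \<open>surj f\<close> by (metis surjD)
    have "bij_betw (\<lambda>x. x + z) {x. f x = b} {x. f x = a}"
    proof (rule bij_betw_byWitness[where f' = "\<lambda>x. x - z"])
      have "f (x - z) = f x - f z" for x
        using add[of "x - z" z] by (simp add: algebra_simps)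
      then show "(\<lambda>x. x - z) ` {x. f x = a} \<subseteq> {x. f x = b}"
        using z by auto
    qed (use z add in auto)
    then show ?thesis
      by (rule bij_betw_same_card)
  qed
  have "CARD('a) = (\<Sum>b\<in>UNIV. card {x. f x = b})"
    using sum_card_fibers[of "\<lambda>_. True" f] by simp
  also have "\<dots> = (\<Sum>b\<in>(UNIV :: 'b set). card {x. f x = a})"
    by (intro sum.cong refl eq)
  also have "\<dots> = CARD('b) * card {x. f x = a}"
    by simp
  finally show ?thesis ..
qed

section \<open>Squares and nonsquares in a finite field\<close>

lemma card_square_roots:
  fixes c :: "'a :: idom"
  assumes "(2 :: 'a) \<noteq> 0" "c \<noteq> 0"
  shows "card {x. x ^ 2 = c ^ 2} = 2"
proof -
  have "c \<noteq> - c"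
  proof
    assume "c = - c"
    then have "2 * c = 0"
      by (metis mult_2 add.right_inverse)
    then show False
      using assms by simp
  qed
  moreover have "{x. x ^ 2 = c ^ 2} = {c, - c}"
    by (auto simp: power2_eq_iff)
  ultimately show ?thesis
    by simp
qed

text \<open>Squaring is two-to-one on nonzero elements, so the nonzero squares make up half of them.
  Their multiples by \<open>u\<close> are equally many and disjoint from them, hence fill the other
  half.\<close>

lemma nonzero_square_or_nonsquare_mult:
  fixes u y :: "'a :: finite_field"
  assumes two: "(2 :: 'a) \<noteq> 0" and u: "\<nexists>c. u = c ^ 2" and y: "y \<noteq> 0"
  shows "\<exists>c. c \<noteq> 0 \<and> (y = c ^ 2 \<or> y = u * c ^ 2)"
proof -
  let ?V = "{x :: 'a. x \<noteq> 0}"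
  let ?S = "(\<lambda>x. x ^ 2) ` ?V"
  have u0: "u \<noteq> 0"
    using u by (metis zero_power2)
  have "card ?V = (\<Sum>b\<in>?S. card {x \<in> ?V. x ^ 2 = b})"
    using sum.group[of ?V ?S "\<lambda>x. x ^ 2" "\<lambda>_. 1 :: nat"] by simp
  also have "\<dots> = (\<Sum>b\<in>?S. 2)"
  proof (rule sum.cong[OF refl])
    fix b assume "b \<in> ?S"
    then obtain c where c: "c \<noteq> 0" "b = c ^ 2"
      by auto
    then have "{x \<in> ?V. x ^ 2 = b} = {x. x ^ 2 = c ^ 2}"
      by auto
    then show "card {x \<in> ?V. x ^ 2 = b} = 2"
      using card_square_roots[OF two c(1)] by simp
  qed
  finally have V: "card ?V = 2 * card ?S"
    by simp
  have "card ((*) u ` ?S) = card ?S"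
    using u0 by (intro card_image inj_onI) simp
  moreover have "?S \<inter> (*) u ` ?S = {}"
  proof (rule ccontr)
    assume "?S \<inter> (*) u ` ?S \<noteq> {}"
    then obtain c d where "d \<noteq> 0" "c ^ 2 = u * d ^ 2"
      by auto
    then have "u = (c / d) ^ 2"
      by (simp add: power_divide field_simps)
    then show False
      using u by blast
  qed
  ultimately have "card (?S \<union> (*) u ` ?S) = card ?V"
    using V by (simp add: card_Un_disjoint)
  moreover have "?S \<union> (*) u ` ?S \<subseteq> ?V"
    using u0 by auto
  ultimately have "?S \<union> (*) u ` ?S = ?V"
    by (intro card_subset_eq) auto
  then show ?thesis
    using y by blast
qed

text \<open>A nonzero \<open>y\<close> lies in exactly one of the two square classes and has two
  roots there; \<open>y = 0\<close> has one root on each side.\<close>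

lemma card_square_roots_nonsquare:
  fixes u y :: "'a :: finite_field"
  assumes two: "(2 :: 'a) \<noteq> 0" and u: "\<nexists>c. u = c ^ 2"
  shows "card {x. x ^ 2 = y} + card {x. u * x ^ 2 = y} = 2"
proof (cases "y = 0")
  case True
  have "u \<noteq> 0"
    using u by (metis zero_power2)
  then have "{x. x ^ 2 = y} = {0}" "{x. u * x ^ 2 = y} = {0}"
    using True by auto
  then show ?thesis
    by simp
next
  case False
  then obtain c where c: "c \<noteq> 0" "y = c ^ 2 \<or> y = u * c ^ 2"
    using nonzero_square_or_nonsquare_mult[OF two u] by blast
  have u0: "u \<noteq> 0"
    using u by (metis zero_power2)
  have no: "d ^ 2 \<noteq> u * e ^ 2" if "d \<noteq> 0 \<or> e \<noteq> 0" for d e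
  proof
    assume *: "d ^ 2 = u * e ^ 2"
    then have "e \<noteq> 0"
      using that by auto
    then have "u = (d / e) ^ 2"
      using * by (simp add: power_divide field_simps)
    then show False
      using u by blast
  qed
  from c(2) show ?thesis
  proof
    assume y: "y = c ^ 2"
    have "u * x ^ 2 \<noteq> y" for x
      using no[of c x] c(1) y by metis
    then have "{x. u * x ^ 2 = y} = {}"
      by simp
    then show ?thesis
      using card_square_roots[OF two c(1)] y by simp
  next
    assume y: "y = u * c ^ 2"
    have "{x. x ^ 2 = y} = {}"
      using no[of _ c] c(1) y by force
    moreover have "{x. u * x ^ 2 = y} = {x. x ^ 2 = c ^ 2}"
      using u0 y by auto
    ultimately show ?thesis
      using card_square_roots[OF two c(1)] by simp
  qed
qed

text \<open>On a finite set a surjective squaring map would be injective, but 1 and -1 have the same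
  square.\<close>

lemma nonsquare_exists:
  assumes "(2 :: 'a :: finite_field) \<noteq> 0"
  shows "\<exists>g :: 'a. \<nexists>c. g = c ^ 2"
proof (rule ccontr)
  assume "\<not> ?thesis"
  then have "surj (\<lambda>c :: 'a. c ^ 2)"
    by (metis surjI surj_def)
  then have "inj (\<lambda>c :: 'a. c ^ 2)"
    by (simp add: finite_UNIV_surj_inj)
  then have "(1 :: 'a) = - 1"
    by (auto dest: injD[where x = 1 and y = "-1"])
  then have "(2 :: 'a) = 0"
    by (metis add.right_inverse one_add_one)
  then show False
    using assms by simp
qed

lemma even_sum_powers_iff:
  fixes p n :: nat
  assumes "odd p"
  shows "even (\<Sum>i<n. p ^ i) \<longleftrightarrow> even n"
  using assms by (induction n) auto

text \<open>The witness is the norm \<open>g ^ (1 + p + \<dots> + p ^ (m - 1))\<close> of a nonsquare \<open>g\<close>: the exponent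
  is odd, so the norm differs from \<open>g\<close> by a square.\<close>

lemma prime_field_nonsquare_exists:
  assumes two: "(2 :: 'q :: finite_field) \<noteq> 0"
    and card: "CARD('q) = CHAR('q) ^ m" and odd: "odd CHAR('q)" "odd m"
  shows "\<exists>u :: 'q gfp. \<nexists>c :: 'q. of_gfp u = c ^ 2"
proof -
  let ?p = "CHAR('q)"
  let ?s = "\<Sum>i<m. ?p ^ i"
  obtain g :: 'q where g: "\<nexists>c. g = c ^ 2"
    using nonsquare_exists[OF two] by blast
  then have g0: "g \<noteq> 0"
    by (metis zero_power2)
  obtain j where j: "?s = 2 * j + 1"
    using even_sum_powers_iff[OF odd(1), of m] odd(2) by (metis oddE)
  \<comment> \<open>The geometric sum, stated without subtraction. It shows that the Frobenius map
    fixes \<open>g ^ ?s\<close>, which therefore lies in the prime subfield.\<close>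
  have "?s * ?p + 1 = ?s + ?p ^ m"
  proof (induction m)
    case (Suc m)
    then show ?case
      by (simp add: algebra_simps)
  qed simp
  then have "(g ^ ?s) ^ ?p * g = g ^ ?s * g ^ (?p ^ m)"
    by (metis power_add power_mult power_one_right)
  moreover have "g ^ (?p ^ m) = g"
    using finite_field_power_card_eq_same[of g] card by simp
  ultimately have "(g ^ ?s) ^ ?p = g ^ ?s"
    using g0 by simp
  then obtain u :: "'q gfp" where u: "of_gfp u = g ^ ?s"
    using range_of_gfp by (metis (mono_tags, lifting) mem_Collect_eq imageE)
  have "of_gfp u \<noteq> c ^ 2" for c :: 'q
  proof
    assume "of_gfp u = c ^ 2"
    then have "g * (g ^ j) ^ 2 = c ^ 2"
      using u j by (simp add: power_mult mult.commute power_even_eq)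
    then have "g = (c / g ^ j) ^ 2"
      using g0 by (simp add: power_divide field_simps)
    then show False
      using g by blast
  qed
  then show ?thesis
    by blast
qed

section \<open>The embedding of the prime field\<close>

lemma of_gfp_eq_0_iff [simp]: "of_gfp a = 0 \<longleftrightarrow> a = 0"
  using inj_of_gfp of_gfp_0 by (metis injD)

lemma of_gfp_minus: "of_gfp (- a) = - of_gfp a"
  using of_gfp_add[of a "- a"] by (simp add: of_gfp_0 add_eq_0_iff)

lemma of_gfp_power: "of_gfp (a ^ n) = of_gfp a ^ n"
  by (induction n) (simp_all add: of_gfp_1 of_gfp_mult)

lemma of_gfp_divide: "of_gfp (a / b) = of_gfp a / of_gfp b"
proof (cases "b = 0")
  case False
  have "of_gfp (a / b) * of_gfp b = of_gfp a"
    using False by (simp flip: of_gfp_mult)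
  then show ?thesis
    using False by (simp add: field_simps)
qed (simp add: of_gfp_0)

section \<open>The trace\<close>

lemma tr_add:
  fixes x y :: "'q :: finite_field"
  assumes "CARD('q) = CHAR('q) ^ m"
  shows "tr m (x + y) = tr m x + tr m y"
proof -
  have "prime CHAR('q)"
    by (rule prime_CHAR_semidom) simp
  then have "of_gfp (tr m (x + y)) = (of_gfp (tr m x + tr m y) :: 'q)"
    by (simp add: of_gfp_tr[OF assms] of_gfp_add freshmans_dream' sum.distrib)
  then show ?thesis
    by (rule injD[OF inj_of_gfp])
qed

lemma tr_scale:
  fixes x :: "'q :: finite_field"
  assumes "CARD('q) = CHAR('q) ^ m"
  shows "tr m (of_gfp a * x) = a * tr m x"
proof -
  have "(of_gfp a :: 'q) ^ CHAR('q) = of_gfp a"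
    using range_of_gfp by blast
  then have "(of_gfp a :: 'q) ^ (CHAR('q) ^ i) = of_gfp a" for i
    by (induction i) (simp_all add: power_mult)
  then have "of_gfp (tr m (of_gfp a * x)) = (of_gfp (a * tr m x) :: 'q)"
    by (simp add: of_gfp_tr[OF assms] of_gfp_mult power_mult_distrib sum_distrib_left)
  then show ?thesis
    by (rule injD[OF inj_of_gfp])
qed

text \<open>The trace is given by a nonzero polynomial of degree at most \<open>p ^ (m - 1)\<close>,
  which has too few roots to vanish on all \<open>p ^ m\<close> elements.\<close>

lemma tr_nonzero:
  assumes "CARD('q :: finite_field) = CHAR('q) ^ m" "m > 0"
  shows "\<exists>x :: 'q. tr m x \<noteq> 0"
proof (rule ccontr)
  let ?p = "CHAR('q)"
  let ?f = "\<Sum>i<m. Polynomial.monom 1 (?p ^ i) :: 'q poly"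
  assume "\<not> ?thesis"
  then have z: "(\<Sum>i<m. x ^ (?p ^ i)) = 0" for x :: 'q
    using of_gfp_tr[OF assms(1), of x] by (simp add: of_gfp_0)
  have "prime ?p"
    by (rule prime_CHAR_semidom) simp
  then have p1: "?p > 1"
    by (rule prime_gt_1_nat)
  have "Polynomial.coeff ?f 1 = (\<Sum>i<m. if i = 0 then 1 else 0)"
    unfolding Polynomial.coeff_sum using p1 by (intro sum.cong) auto
  also have "\<dots> = 1"
    using assms(2) by simp
  finally have "?f \<noteq> 0"
    by (metis Polynomial.coeff_0 zero_neq_one)
  then have "card {x. poly ?f x = 0} \<le> Polynomial.degree ?f"
    by (rule card_poly_roots_bound)
  moreover have "{x. poly ?f x = 0} = UNIV"
    using z by (simp add: poly_sum poly_monom)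
  moreover have "Polynomial.degree ?f \<le> ?p ^ (m - 1)"
    using p1 by (intro degree_sum_le order.trans[OF degree_monom_le] power_increasing) auto
  ultimately have "?p ^ m \<le> ?p ^ (m - 1)"
    using assms(1) by simp
  then show False
    using p1 assms(2) by (simp add: power_increasing_iff)
qed

section \<open>The quadratic form \<open>T (x\<^sup>2)\<close>\<close>

text \<open>The odd degree \<open>m > 1\<close> is written as \<open>2 * k + 3\<close>, so that no truncated subtraction occurs.\<close>

locale odd_degree_trace =
  fixes T :: "'q :: finite_field \<Rightarrow> 'q gfp" and p k :: nat
  assumes T_add: "T (x + y) = T x + T y"
    and T_scale: "T (of_gfp a * x) = a * T x"
    and T_nonzero: "\<exists>x. T x \<noteq> 0"
    and char_q [simp]: "CHAR('q) = p"
    and odd_p: "odd p"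
    and card_q: "CARD('q) = p ^ (2 * k + 3)"
begin

definition N :: "'q gfp \<Rightarrow> nat" where
  "N a = card {x. T (x ^ 2) = a}"

text \<open>This is \<open>p - 1\<close> times the weight of the codeword of \<open>x\<close> (see
  \<open>hamming_weight_codeword\<close>). Counting over all isotropic vectors postpones the choice
  of representatives.\<close>

definition W :: "'q \<Rightarrow> nat" where
  "W x = card {y. T (y ^ 2) = 0 \<and> T (x * y) \<noteq> 0}"

lemma prime_p: "prime p"
proof -
  have "prime CHAR('q)"
    by (rule prime_CHAR_semidom) (simp del: char_q)
  then show ?thesis
    by simp
qed

lemma p_gt_2: "p > 2"
  using prime_gt_1_nat[OF prime_p] odd_p by (metis even_numeral linorder_neqE_nat not_less_eq numeral_2_eq_2 One_nat_def)

lemma two_neq_0: "(2 :: 'q) \<noteq> 0"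
proof
  assume "(2 :: 'q) = 0"
  then have "of_nat 2 = (0 :: 'q)"
    by simp
  then have "p dvd 2"
    by (simp only: of_nat_eq_0_iff_char_dvd char_q)
  then show False
    using p_gt_2 by (auto dest: dvd_imp_le)
qed

lemma two_neq_0_gfp: "(2 :: 'q gfp) \<noteq> 0"
proof
  assume "(2 :: 'q gfp) = 0"
  then have "of_gfp (1 + 1 :: 'q gfp) = (0 :: 'q)"
    by (simp add: of_gfp_0)
  moreover have "of_gfp (1 + 1 :: 'q gfp) = (1 + 1 :: 'q)"
    by (simp only: of_gfp_add of_gfp_1)
  ultimately have "(1 + 1 :: 'q) = 0"
    by metis
  then show False
    using two_neq_0 by simp
qed

lemma T_0 [simp]: "T 0 = 0"
  using T_scale[of 0 0] by (simp add: of_gfp_0)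

lemma T_scale2: "T (x * (of_gfp a * y)) = a * T (x * y)"
  using T_scale[of a "x * y"] by (simp add: mult.left_commute)

text \<open>Expansion of the quadratic form along a line, with polar form
  \<open>2 * T (x * y)\<close>; both evaluations of \<open>W\<close> rest on it.\<close>

lemma T_square_add_scale:
  "T ((x + of_gfp t * y) ^ 2) = T (x ^ 2) + 2 * t * T (x * y) + t ^ 2 * T (y ^ 2)"
proof -
  have "(x + of_gfp t * y) ^ 2 = x ^ 2 + of_gfp t * (x * y) + of_gfp t * (x * y) + of_gfp (t ^ 2) * y ^ 2"
    by (simp add: of_gfp_mult power2_eq_square algebra_simps)
  then show ?thesis
    by (simp only: T_add T_scale) (simp add: algebra_simps)
qed

text \<open>Nondegeneracy of the trace form: a point \<open>z\<close> of nonzero trace is scaled to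
  the wanted value and divided by \<open>x\<close>.\<close>

lemma surj_T_mult:
  assumes "x \<noteq> 0"
  shows "surj (\<lambda>y. T (x * y))"
proof -
  obtain z where z: "T z \<noteq> 0"
    using T_nonzero by blast
  have "T (x * (of_gfp (a / T z) * (z / x))) = a" for a
    using z assms by (simp add: T_scale2 T_scale)
  then show ?thesis
    by (rule surjI)
qed

lemma card_T_mult:
  assumes "x \<noteq> 0"
  shows "card {y. T (x * y) = a} = p ^ (2 * k + 2)"
proof -
  have "p * card {y. T (x * y) = a} = p * p ^ (2 * k + 2)"
    using card_additive_fiber[of "\<lambda>y. T (x * y)" a] surj_T_mult[OF assms] card_q
    by (simp add: T_add distrib_left eval_nat_numeral)
  then show ?thesis
    using p_gt_2 by simp
qed

lemma card_T_mult_nonzero: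
  assumes "x \<noteq> 0"
  shows "card {y. T (x * y) \<noteq> 0} + p ^ (2 * k + 2) = p ^ (2 * k + 3)"
proof -
  have "card {y. T (x * y) \<noteq> 0} + card {y. T (x * y) = 0}
      = card ({y. T (x * y) \<noteq> 0} \<union> {y. T (x * y) = 0})"
    by (rule card_Un_disjoint[symmetric]) auto
  also have "{y. T (x * y) \<noteq> 0} \<union> {y. T (x * y) = 0} = UNIV"
    by auto
  finally show ?thesis
    using card_T_mult[OF assms] card_q by simp
qed

lemma nonsquare_in_prime_field:
  obtains u :: "'q gfp" where "u \<noteq> 0" "\<nexists>c :: 'q. of_gfp u = c ^ 2"
proof -
  obtain u :: "'q gfp" where u: "\<nexists>c :: 'q. of_gfp u = c ^ 2"
    using prime_field_nonsquare_exists[OF two_neq_0, of "2 * k + 3"] card_q odd_p by auto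
  moreover from u have "u \<noteq> 0"
    by (metis of_gfp_0 zero_power2)
  ultimately show ?thesis
    using that by blast
qed

section \<open>Value distribution of the quadratic form\<close>

text \<open>Both counts are regrouped by the value \<open>y\<close> of \<open>x ^ 2\<close>,
  respectively \<open>of_gfp u * x ^ 2\<close>, on the affine hyperplane \<open>T y = a\<close>;
  every such \<open>y\<close> contributes 2 in total.\<close>

lemma N_add_N_nonsquare:
  assumes u: "\<nexists>c :: 'q. of_gfp u = c ^ 2"
  shows "N a + N (a / u) = 2 * p ^ (2 * k + 2)"
proof -
  let ?R = "{y. T y = a}"
  have u0: "u \<noteq> 0"
    using u by (metis of_gfp_0 zero_power2)
  have "N a = (\<Sum>y\<in>?R. card {x. x ^ 2 = y})"
    using sum_card_fibers_on[of "\<lambda>x. x ^ 2" ?R] by (simp add: N_def)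
  moreover have "N (a / u) = (\<Sum>y\<in>?R. card {x. of_gfp u * x ^ 2 = y})"
  proof -
    have "T (x ^ 2) = a / u \<longleftrightarrow> T (of_gfp u * x ^ 2) = a" for x
      using u0 by (auto simp: T_scale field_simps)
    then show ?thesis
      using sum_card_fibers_on[of "\<lambda>x. of_gfp u * x ^ 2" ?R] by (simp add: N_def)
  qed
  ultimately have "N a + N (a / u) = (\<Sum>y\<in>?R. card {x. x ^ 2 = y} + card {x. of_gfp u * x ^ 2 = y})"
    by (simp only: sum.distrib)
  also have "\<dots> = (\<Sum>y\<in>?R. 2)"
    by (intro sum.cong refl card_square_roots_nonsquare[OF two_neq_0 u])
  finally show ?thesis
    using card_T_mult[of 1 a] by simp
qed

text \<open>For \<open>a = 0\<close> the two terms of the preceding identity coincide.\<close>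

lemma N_0: "N 0 = p ^ (2 * k + 2)"
  using nonsquare_in_prime_field N_add_N_nonsquare[of _ 0]
  by (metis div_0 mult_2 add_left_imp_eq nonzero_mult_div_cancel_left zero_neq_numeral)

text \<open>Scaling \<open>x\<close> by \<open>c\<close> multiplies the form by
  \<open>c ^ 2\<close>. Hence \<open>N\<close> is constant on each square class of the prime
  field.\<close>

lemma N_mult_square:
  assumes "c \<noteq> 0"
  shows "N (c ^ 2 * a) = N a"
proof -
  have scale: "T ((of_gfp d * x) ^ 2) = d ^ 2 * T (x ^ 2)" for d x
    by (simp add: power_mult_distrib T_scale flip: of_gfp_power)
  have "of_gfp (1 / c) * (of_gfp c * x) = x" "of_gfp c * (of_gfp (1 / c) * x) = x" for x :: 'q
    using assms by (simp_all add: of_gfp_1 flip: of_gfp_mult mult.assoc)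
  then have "bij_betw (\<lambda>x. of_gfp c * x) {x. T (x ^ 2) = a} {x. T (x ^ 2) = c ^ 2 * a}"
    using assms
    by (intro bij_betw_byWitness[where f' = "\<lambda>x. of_gfp (1 / c) * x"])
       (auto simp: scale power_divide)
  then show ?thesis
    unfolding N_def by (metis bij_betw_same_card)
qed

lemma sum_N: "(\<Sum>a\<in>UNIV. N a) = p ^ (2 * k + 3)"
  using sum_card_fibers[of "\<lambda>_. True" "\<lambda>x. T (x ^ 2)"] card_q by (simp add: N_def)

text \<open>Since \<open>x\<^sup>2 - y\<^sup>2 = (x + y) * (x - y)\<close>, the second moment of \<open>N\<close> counts pairs
  with \<open>T (v * w) = 0\<close>.\<close>

lemma sum_N_square:
  "(\<Sum>a\<in>UNIV. N a ^ 2) = p ^ (2 * k + 3) + (p ^ (2 * k + 3) - 1) * p ^ (2 * k + 2)"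
proof -
  let ?E = "{z :: 'q \<times> 'q. T (fst z ^ 2) = T (snd z ^ 2)}"
  let ?F = "{z :: 'q \<times> 'q. T (fst z * snd z) = 0}"
  have "(\<Sum>a\<in>UNIV. N a ^ 2) = (\<Sum>a\<in>UNIV. card {z. T (fst z ^ 2) = T (snd z ^ 2) \<and> T (fst z ^ 2) = a})"
  proof (rule sum.cong[OF refl])
    fix a
    have "{z. T (fst z ^ 2) = T (snd z ^ 2) \<and> T (fst z ^ 2) = a} = {x. T (x ^ 2) = a} \<times> {x. T (x ^ 2) = a}"
      by auto
    then show "N a ^ 2 = card {z. T (fst z ^ 2) = T (snd z ^ 2) \<and> T (fst z ^ 2) = a}"
      by (simp add: N_def card_cartesian_product power2_eq_square)
  qed
  also have "\<dots> = card ?E"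
    by (rule sum_card_fibers)
  also have "\<dots> = card ?F"
  proof (rule bij_betw_same_card)
    have T_diff: "T (x - y) = T x - T y" for x y
      using T_add[of "x - y" y] by (simp add: algebra_simps)
    have *: "T (x ^ 2) = T (y ^ 2) \<longleftrightarrow> T ((x + y) * (x - y)) = 0" for x y
      by (simp add: T_diff algebra_simps power2_eq_square)
    have half: "(v + w) / 2 + (v - w) / 2 = v" "(v + w) / 2 - (v - w) / 2 = w" for v w :: 'q
      using two_neq_0 by (simp_all flip: add_divide_distrib diff_divide_distrib mult_2)
    have half': "((x + y) + (x - y)) / 2 = x" "((x + y) - (x - y)) / 2 = y" for x y :: 'q
      using two_neq_0 by (simp_all flip: mult_2)
    \<comment> \<open>The substitution is invertible because 2 is nonzero.\<close>
    show "bij_betw (\<lambda>(x, y). (x + y, x - y)) ?E ?F"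
    proof (rule bij_betw_byWitness[where f' = "\<lambda>(v, w). ((v + w) / 2, (v - w) / 2)"])
      show "(\<lambda>(v, w). ((v + w) / 2, (v - w) / 2)) ` ?F \<subseteq> ?E"
        using * half by (auto simp: half)
    qed (use half half' * in \<open>auto simp: half half'\<close>)
  qed
  also have "\<dots> = (\<Sum>v\<in>UNIV. card {w. T (v * w) = 0})"
  proof -
    have "?F = (SIGMA v:UNIV. {w. T (v * w) = 0})"
      by auto
    then show ?thesis
      by simp
  qed
  \<comment> \<open>The row \<open>v = 0\<close> contributes the whole field, every other row a
    hyperplane.\<close>
  also have "\<dots> = card {w. T (0 * w) = 0} + (\<Sum>v\<in>UNIV-{0}. card {w. T (v * w) = 0})"
    by (rule sum.remove) auto
  also have "(\<Sum>v\<in>UNIV-{0}. card {w. T (v * w) = 0}) = (\<Sum>v\<in>UNIV-{0::'q}. p ^ (2 * k + 2))"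
    by (intro sum.cong card_T_mult) auto
  also have "\<dots> = (p ^ (2 * k + 3) - 1) * p ^ (2 * k + 2)"
    by (simp add: card_Diff_subset card_q)
  finally show ?thesis
    by (simp add: card_q)
qed

text \<open>\<open>N\<close> is constant on square classes, and passing to the other class reflects
  it about \<open>r\<close>, so the squared deviation is the same for all nonzero arguments. It
  vanishes at 0, and the first two moments give the total \<open>(p - 1) * r\<close>.\<close>

lemma N_deviation:
  assumes "a \<noteq> 0"
  shows "(int (N a) - int p ^ (2 * k + 2)) ^ 2 = int p ^ (2 * k + 2)"
proof -
  define r where "r = int p ^ (2 * k + 2)"
  let ?d = "\<lambda>a. (int (N a) - r) ^ 2"
  obtain u :: "'q gfp" where u: "u \<noteq> 0" "\<nexists>c :: 'q. of_gfp u = c ^ 2"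
    by (rule nonsquare_in_prime_field)
  \<comment> \<open>A nonsquare of the large field is a nonsquare of the prime field, so 1 and
    \<open>u\<close> represent the two square classes there.\<close>
  have u': "\<nexists>c. u = c ^ 2"
    using u(2) of_gfp_power by metis
  have flip: "int (N b) + int (N (b / u)) = 2 * r" for b
    using arg_cong[OF N_add_N_nonsquare[OF u(2), of b], of int] by (simp add: r_def)
  have const: "?d b = ?d 1" if b: "b \<noteq> 0" for b
  proof -
    obtain c where c: "c \<noteq> 0" "b = c ^ 2 \<or> b = u * c ^ 2"
      using nonzero_square_or_nonsquare_mult[OF two_neq_0_gfp u' b] by blast
    from c(2) show ?thesis
    proof
      assume "b = c ^ 2"
      then show ?thesis
        using N_mult_square[OF c(1), of 1] by simp
    next
      assume "b = u * c ^ 2"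
      then have "int (N b) + int (N 1) = 2 * r"
        using flip[of b] N_mult_square[OF c(1), of 1] u by simp
      then have "int (N b) - r = - (int (N 1) - r)"
        by simp
      then show ?thesis
        by (metis power2_minus)
    qed
  qed
  have pr: "int p * r = int (p ^ (2 * k + 3))"
    by (simp add: r_def eval_nat_numeral)
  have "(\<Sum>a\<in>UNIV. ?d a) = ?d 0 + (\<Sum>a\<in>UNIV-{0}. ?d a)"
    by (rule sum.remove) auto
  also have "?d 0 = 0"
    by (simp add: N_0 r_def)
  also have "(\<Sum>a\<in>UNIV-{0}. ?d a) = (\<Sum>a\<in>UNIV-{0::'q gfp}. ?d 1)"
    by (intro sum.cong refl const) simp
  also have "\<dots> = (int p - 1) * ?d 1"
    using p_gt_2 by (simp add: card_Diff_subset of_nat_diff)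
  finally have A: "(\<Sum>a\<in>UNIV. ?d a) = (int p - 1) * ?d 1"
    by simp
  have "(\<Sum>a\<in>UNIV. ?d a) = (\<Sum>a\<in>UNIV. int (N a ^ 2) - 2 * r * int (N a) + r ^ 2)"
    by (intro sum.cong) (auto simp: power2_eq_square algebra_simps)
  also have "\<dots> = int (\<Sum>a\<in>UNIV. N a ^ 2) - 2 * r * int (\<Sum>a\<in>UNIV. N a) + int p * r ^ 2"
    by (simp add: sum.distrib sum_subtractf sum_distrib_left)
  also have "int (\<Sum>a\<in>UNIV. N a) = int p * r"
    unfolding sum_N pr ..
  also have "int (\<Sum>a\<in>UNIV. N a ^ 2) = int p * r + (int p * r - 1) * r"
    unfolding sum_N_square pr using p_gt_2 by (simp add: of_nat_diff r_def)
  also have "int p * r + (int p * r - 1) * r - 2 * r * (int p * r) + int p * r ^ 2 = (int p - 1) * r"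
    by (simp add: power2_eq_square algebra_simps)
  finally have "(int p - 1) * ?d 1 = (int p - 1) * r"
    using A by simp
  then have "?d 1 = r"
    using p_gt_2 by simp
  then show ?thesis
    using const[OF assms] by (simp add: r_def)
qed

text \<open>Of \<open>plus_values\<close> and \<open>minus_values\<close>, one consists of the
  nonzero squares of the prime field and the other of its nonsquares; defining them through
  \<open>N\<close> leaves open which is which.\<close>

definition plus_values :: "'q gfp set" where
  "plus_values = {a. a \<noteq> 0 \<and> N a = p ^ (2 * k + 2) + p ^ (k + 1)}"

definition minus_values :: "'q gfp set" where
  "minus_values = {a. a \<noteq> 0 \<and> N a = p ^ (2 * k + 2) - p ^ (k + 1)}"

text \<open>These bounds make the truncated subtractions in \<open>minus_values\<close> and in the
  weights genuine.\<close>

lemma p_power_less: "p ^ k < p ^ (2 * k + 1)" "p ^ (k + 1) < p ^ (2 * k + 2)"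
  by (rule power_strict_increasing; use p_gt_2 in simp)+

lemma plus_minus_values_Un: "plus_values \<union> minus_values = UNIV - {0}"
proof -
  have "a \<in> plus_values \<or> a \<in> minus_values" if "a \<noteq> 0" for a
  proof -
    have "int p ^ (2 * k + 2) = (int p ^ (k + 1)) ^ 2"
      unfolding power_mult[symmetric] by (rule arg_cong[where f = "power (int p)"]) simp
    then have "(int (N a) - int p ^ (2 * k + 2)) ^ 2 = (int p ^ (k + 1)) ^ 2"
      using N_deviation[OF that] by simp
    then have "int (N a) - int p ^ (2 * k + 2) = int p ^ (k + 1) \<or> int (N a) - int p ^ (2 * k + 2) = - (int p ^ (k + 1))"
      by (simp only: power2_eq_iff)
    \<comment> \<open>The case of the minus sign is rearranged into a sum before the return to
      natural numbers, where subtraction truncates.\<close>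
    then have "int (N a) = int (p ^ (2 * k + 2)) + int (p ^ (k + 1)) \<or> int (N a) + int (p ^ (k + 1)) = int (p ^ (2 * k + 2))"
      by (simp only: of_nat_power) linarith
    then have "N a = p ^ (2 * k + 2) + p ^ (k + 1) \<or> N a + p ^ (k + 1) = p ^ (2 * k + 2)"
      by (simp only: of_nat_add[symmetric] of_nat_eq_iff)
    then show ?thesis
      using that unfolding plus_values_def minus_values_def mem_Collect_eq by linarith
  qed
  then show ?thesis
    by (auto simp: plus_values_def minus_values_def)
qed

lemma plus_minus_values_disjoint: "plus_values \<inter> minus_values = {}"
proof -
  have "p ^ (k + 1) > 0"
    using p_gt_2 by simp
  then have "p ^ (2 * k + 2) + p ^ (k + 1) \<noteq> p ^ (2 * k + 2) - p ^ (k + 1)"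
    by linarith
  then show ?thesis
    unfolding plus_values_def minus_values_def by force
qed

text \<open>Division by a nonsquare reflects \<open>N\<close> about its mean and so exchanges the
  two sets, which together contain all \<open>p - 1\<close> nonzero values.\<close>

lemma card_plus_minus_values:
  "2 * card plus_values = p - 1" "2 * card minus_values = p - 1"
proof -
  obtain u :: "'q gfp" where u: "u \<noteq> 0" "\<nexists>c :: 'q. of_gfp u = c ^ 2"
    by (rule nonsquare_in_prime_field)
  have flip: "N b + N (b / u) = 2 * p ^ (2 * k + 2)" for b
    by (rule N_add_N_nonsquare[OF u(2)])
  have "bij_betw (\<lambda>a. a / u) plus_values minus_values"
  proof (rule bij_betw_byWitness[where f' = "\<lambda>a. a * u"])
    show "(\<lambda>a. a / u) ` plus_values \<subseteq> minus_values"
    proof safe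
      fix a assume "a \<in> plus_values"
      then show "a / u \<in> minus_values"
        using flip[of a] u(1) unfolding plus_values_def minus_values_def mem_Collect_eq
        by auto
    qed
    show "(\<lambda>a. a * u) ` minus_values \<subseteq> plus_values"
    proof safe
      fix a assume "a \<in> minus_values"
      then have a: "a \<noteq> 0" "N a = p ^ (2 * k + 2) - p ^ (k + 1)"
        by (simp_all add: minus_values_def)
      have "N (a * u) + N a = 2 * p ^ (2 * k + 2)"
        using flip[of "a * u"] u(1) by simp
      then have "N (a * u) = p ^ (2 * k + 2) + p ^ (k + 1)"
        using a(2) p_power_less(2) by linarith
      then show "a * u \<in> plus_values"
        using a(1) u(1) by (simp add: plus_values_def)
    qed
  qed (use u in auto)
  then have "card plus_values = card minus_values"
    by (rule bij_betw_same_card)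
  moreover have "card plus_values + card minus_values = p - 1"
    using card_Un_disjoint[OF _ _ plus_minus_values_disjoint]
    by (simp add: plus_minus_values_Un card_Diff_subset)
  ultimately show "2 * card plus_values = p - 1" "2 * card minus_values = p - 1"
    by simp_all
qed

section \<open>Isotropic vectors off a hyperplane\<close>

text \<open>Translating \<open>y\<close> along the isotropic \<open>x\<close> preserves
  \<open>T (x * y)\<close> and changes \<open>T (y ^ 2)\<close> linearly. Off the hyperplane
  \<open>T (x * y) = 0\<close> the form thus takes all \<open>p\<close> values equally
  often.\<close>

lemma W_isotropic:
  assumes x: "x \<noteq> 0" "T (x ^ 2) = 0"
  shows "p * W x = (p - 1) * p ^ (2 * k + 2)"
proof -
  let ?A = "{y. T (x * y) \<noteq> 0}"
  have "card {y. T (x * y) \<noteq> 0 \<and> T (y ^ 2) = c} = W x" for c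
    unfolding W_def
  proof (rule bij_betw_same_card)
    \<comment> \<open>The multiplier \<open>t\<close> solves \<open>2 * t * T (x * y) = d\<close>,
      so that the form grows by exactly \<open>d\<close>.\<close>
    define f where "f = (\<lambda>d y. y + of_gfp (d / (2 * T (x * y))) * x)"
    have T1: "T (x * f d y) = T (x * y)" for d y
      using x(2) by (simp add: f_def distrib_left T_add T_scale2 flip: power2_eq_square)
    have T2: "T (f d y ^ 2) = T (y ^ 2) + d" if "T (x * y) \<noteq> 0" for d y
    proof -
      have "T (f d y ^ 2) = T (y ^ 2) + 2 * (d / (2 * T (x * y))) * T (x * y)"
        unfolding f_def T_square_add_scale x(2) mult.commute[of y x] by simp
      then show ?thesis
        using that two_neq_0_gfp by simp
    qed
    \<comment> \<open>The multiplier depends on \<open>y\<close> only through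
      \<open>T (x * y)\<close>, which \<open>f\<close> preserves, so the two shifts cancel.\<close>
    have inv: "f d (f (- d) y) = y" for d y
    proof -
      have "f d (f (- d) y) = f (- d) y + of_gfp (d / (2 * T (x * y))) * x"
        unfolding f_def[THEN fun_cong, THEN fun_cong, of d] T1 ..
      then show ?thesis
        by (simp add: f_def of_gfp_minus)
    qed
    show "bij_betw (f (- c)) {y. T (x * y) \<noteq> 0 \<and> T (y ^ 2) = c} {y. T (y ^ 2) = 0 \<and> T (x * y) \<noteq> 0}"
    proof (rule bij_betw_byWitness[where f' = "f c"])
      show "\<forall>y\<in>{y. T (x * y) \<noteq> 0 \<and> T (y ^ 2) = c}. f c (f (- c) y) = y"
        using inv by blast
      show "\<forall>y\<in>{y. T (y ^ 2) = 0 \<and> T (x * y) \<noteq> 0}. f (- c) (f c y) = y"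
        using inv[of "- c"] by simp
    qed (auto simp: T1 T2)
  qed
  then have "card ?A = p * W x"
    using sum_card_fibers[of "\<lambda>y. T (x * y) \<noteq> 0" "\<lambda>y. T (y ^ 2)"] by simp
  moreover have "card ?A = p * p ^ (2 * k + 2) - p ^ (2 * k + 2)"
    using card_T_mult_nonzero[OF x(1)] by (simp add: eval_nat_numeral)
  ultimately show ?thesis
    by (simp add: diff_mult_distrib)
qed

text \<open>Stereographic projection: count the pairs \<open>(t, w)\<close> with \<open>T ((x + t * w)\<^sup>2) = T (x\<^sup>2)\<close>,
  where \<open>t\<close> and \<open>w\<close> are nonzero, first by \<open>t\<close> and then by the direction \<open>w\<close>. For fixed \<open>w\<close> the
  condition is the linear equation \<open>2 * T (x * w) + t * T (w\<^sup>2) = 0\<close> in \<open>t\<close>.\<close>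

lemma W_anisotropic:
  assumes a: "T (x ^ 2) = a" "a \<noteq> 0"
  shows "p * W x + (p - 1) * N a = 2 * (p - 1) * p ^ (2 * k + 2)"
proof -
  let ?X = "{z :: 'q gfp \<times> 'q. fst z \<noteq> 0 \<and> snd z \<noteq> 0 \<and> T ((x + of_gfp (fst z) * snd z) ^ 2) = a}"
  have x0: "x \<noteq> 0"
    using a by auto
  have "card ?X = (\<Sum>t\<in>UNIV-{0}. card {w. w \<noteq> 0 \<and> T ((x + of_gfp t * w) ^ 2) = a})"
  proof -
    have "?X = (SIGMA t:UNIV-{0}. {w. w \<noteq> 0 \<and> T ((x + of_gfp t * w) ^ 2) = a})"
      by auto
    then show ?thesis
      by simp
  qed
  also have "\<dots> = (\<Sum>t\<in>UNIV-{0 :: 'q gfp}. N a - 1)"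
  proof (rule sum.cong[OF refl])
    fix t :: "'q gfp" assume "t \<in> UNIV - {0}"
    then have t: "(of_gfp t :: 'q) \<noteq> 0"
      by simp
    \<comment> \<open>For fixed \<open>t\<close> the points \<open>x + of_gfp t * w\<close> run
      through the level set of \<open>a\<close> without \<open>x\<close> itself, which belongs to
      \<open>w = 0\<close>.\<close>
    have "card {w. w \<noteq> 0 \<and> T ((x + of_gfp t * w) ^ 2) = a} = card ({y. T (y ^ 2) = a} - {x})"
      using t by (intro bij_betw_same_card[of "\<lambda>w. x + of_gfp t * w"]
          bij_betw_byWitness[where f' = "\<lambda>y. (y - x) / of_gfp t"]) auto
    then show "card {w. w \<noteq> 0 \<and> T ((x + of_gfp t * w) ^ 2) = a} = N a - 1"
      using a(1) by (simp add: N_def)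
  qed
  also have "\<dots> = (p - 1) * (N a - 1)"
    by (simp add: card_Diff_subset)
  finally have 1: "card ?X = (p - 1) * (N a - 1)" .

  let ?B = "{w. T (w ^ 2) \<noteq> 0 \<and> T (x * w) \<noteq> 0}"
  let ?Z = "{w. w \<noteq> 0 \<and> T (w ^ 2) = 0 \<and> T (x * w) = 0}"
  let ?n = "\<lambda>w. card {t :: 'q gfp. t \<noteq> 0 \<and> 2 * T (x * w) + t * T (w ^ 2) = 0}"
  have "card ?X = (\<Sum>w\<in>UNIV-{0}. card {t. t \<noteq> 0 \<and> T ((x + of_gfp t * w) ^ 2) = a})"
  proof -
    have "card ?X = card (SIGMA w:UNIV-{0}. {t. t \<noteq> 0 \<and> T ((x + of_gfp t * w) ^ 2) = a})"
      by (intro bij_betw_same_card[of prod.swap] bij_betw_byWitness[where f' = prod.swap]) auto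
    then show ?thesis
      by simp
  qed
  also have "\<dots> = (\<Sum>w\<in>UNIV-{0}. ?n w)"
  proof (intro sum.cong refl arg_cong[of _ _ card] Collect_cong conj_cong)
    fix w t assume "(t :: 'q gfp) \<noteq> 0"
    moreover have "2 * t * T (x * w) + t ^ 2 * T (w ^ 2) = t * (2 * T (x * w) + t * T (w ^ 2))"
      by (simp add: algebra_simps power2_eq_square)
    ultimately show "T ((x + of_gfp t * w) ^ 2) = a \<longleftrightarrow> 2 * T (x * w) + t * T (w ^ 2) = 0"
      unfolding T_square_add_scale a(1) add.assoc by simp
  qed
  \<comment> \<open>An anisotropic direction has a single root \<open>t\<close>, nonzero iff
    \<open>T (x * w)\<close> is nonzero. An isotropic direction admits every nonzero
    \<open>t\<close> if \<open>T (x * w) = 0\<close>, and none otherwise.\<close>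
  also have "\<dots> = (\<Sum>w\<in>UNIV-{0}. (if w \<in> ?B then 1 else 0) + (if w \<in> ?Z then p - 1 else 0))"
  proof (rule sum.cong[OF refl])
    fix w :: 'q assume w: "w \<in> UNIV - {0}"
    show "?n w = (if w \<in> ?B then 1 else 0) + (if w \<in> ?Z then p - 1 else 0)"
    proof (cases "T (w ^ 2) = 0")
      case True
      have "{t :: 'q gfp. t \<noteq> 0} = UNIV - {0}"
        by auto
      then show ?thesis
        using True w two_neq_0_gfp by (simp add: card_Diff_subset)
    next
      case False
      have "2 * T (x * w) + t * T (w ^ 2) = 0 \<longleftrightarrow> t = - (2 * T (x * w)) / T (w ^ 2)" for t
        using False by (metis add_eq_0_iff nonzero_eq_divide_eq)
      then have "{t. t \<noteq> 0 \<and> 2 * T (x * w) + t * T (w ^ 2) = 0} =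
          (if T (x * w) = 0 then {} else {- (2 * T (x * w)) / T (w ^ 2)})"
        using False two_neq_0_gfp by auto
      then show ?thesis
        using False by simp
    qed
  qed
  also have "\<dots> = card ?B + (p - 1) * card ?Z"
  proof -
    have "(UNIV - {0}) \<inter> ?B = ?B" "(UNIV - {0}) \<inter> ?Z = ?Z"
      by auto
    then show ?thesis
      by (simp add: sum.distrib sum.If_cases del: mem_Collect_eq)
  qed
  finally have 2: "card ?X = card ?B + (p - 1) * card ?Z" .

  \<comment> \<open>The set counted by \<open>W x\<close> complements \<open>?B\<close> within the
    vectors off the hyperplane and \<open>?Z\<close> within the nonzero isotropic vectors; this
    eliminates both cardinalities.\<close>
  have "card ?B + W x = card (?B \<union> {y. T (y ^ 2) = 0 \<and> T (x * y) \<noteq> 0})"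
    unfolding W_def by (intro card_Un_disjoint[symmetric]) auto
  also have "?B \<union> {y. T (y ^ 2) = 0 \<and> T (x * y) \<noteq> 0} = {y. T (x * y) \<noteq> 0}"
    by auto
  finally have 3: "card ?B + W x + p ^ (2 * k + 2) = p ^ (2 * k + 3)"
    using card_T_mult_nonzero[OF x0] by simp
  have "card ?Z + W x = card (?Z \<union> {y. T (y ^ 2) = 0 \<and> T (x * y) \<noteq> 0})"
    unfolding W_def by (intro card_Un_disjoint[symmetric]) auto
  also have "?Z \<union> {y. T (y ^ 2) = 0 \<and> T (x * y) \<noteq> 0} = {y. T (y ^ 2) = 0} - {0}"
    by auto
  also have "card \<dots> = N 0 - 1"
    by (simp add: N_def)
  finally have 4: "card ?Z + W x + 1 = p ^ (2 * k + 2)"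
    using p_gt_2 by (simp add: N_0)
  \<comment> \<open>The level set contains \<open>x\<close>, so \<open>N a - 1\<close> is not
    truncated.\<close>
  have "x \<in> {y. T (y ^ 2) = a}"
    using a by simp
  then have "N a > 0"
    unfolding N_def by (metis card_gt_0_iff empty_iff finite)
  then obtain n where n: "N a = Suc n"
    using gr0_implies_Suc by blast
  obtain h where h: "p = Suc h"
    using p_gt_2 by (metis less_imp_Suc_add)
  have 5: "h * n = card ?B + h * card ?Z"
    using 1 2 n h by simp
  have "p ^ (2 * k + 3) = p * p ^ (2 * k + 2)"
    by (simp add: eval_nat_numeral)
  also have "\<dots> = h * p ^ (2 * k + 2) + p ^ (2 * k + 2)"
    using arg_cong[OF h, of "\<lambda>z. z * p ^ (2 * k + 2)"] by simp
  finally have 6: "card ?B + W x = h * p ^ (2 * k + 2)"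
    using 3 by simp
  have "p * W x = W x + h * W x"
    using arg_cong[OF h, of "\<lambda>z. z * W x"] by simp
  then have "p * W x + h * N a = (card ?B + W x) + h * (card ?Z + W x + 1)"
    using 5 n by (simp add: algebra_simps)
  also have "\<dots> = 2 * h * p ^ (2 * k + 2)"
    unfolding 6 4 by simp
  finally show ?thesis
    using h by simp
qed

end

section \<open>The trace code\<close>

text \<open>Coordinates in a finite basis identify the space with the functions from the basis to
  the scalars. The dimension of the code is later read off from this count.\<close>

lemma (in vectorspace) card_carrier_eq_power_dim:
  assumes "finite (carrier V)"
  shows "card (carrier V) = card (carrier K) ^ dim"
proof -
  have "span (carrier V) = carrier V"
    using in_own_span[of "carrier V"] span_is_subset2[of "carrier V"] by auto
  then have fin_dim
    unfolding fin_dim_def using assms by blast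
  then obtain B where B: "finite B" "basis B"
    using finite_basis_exists by blast
  then have BV: "B \<subseteq> carrier V"
    by (simp add: basis_def)
  have unique: "\<exists>!a. a \<in> B \<rightarrow>\<^sub>E carrier K \<and> lincomb a B = v" if "v \<in> carrier V" for v
    using basis_criterion[OF B(1) BV] B(2) that by blast
  have closed: "lincomb a B \<in> carrier V" if "a \<in> B \<rightarrow>\<^sub>E carrier K" for a
    using that BV by (intro lincomb_closed) auto
  have "bij_betw (\<lambda>a. lincomb a B) (B \<rightarrow>\<^sub>E carrier K) (carrier V)"
    unfolding bij_betw_def
  proof
    show "inj_on (\<lambda>a. lincomb a B) (B \<rightarrow>\<^sub>E carrier K)"
      by (rule inj_onI) (metis closed unique)
    show "(\<lambda>a. lincomb a B) ` (B \<rightarrow>\<^sub>E carrier K) = carrier V"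
      using closed unique by blast
  qed
  then have "card (carrier V) = card (B \<rightarrow>\<^sub>E carrier K)"
    by (simp add: bij_betw_same_card)
  also have "\<dots> = card (carrier K) ^ card B"
    using B(1) by (rule card_funcsetE)
  finally show ?thesis
    using dim_basis[OF B] by simp
qed

lemma card_nth_eq_card_set:
  assumes "distinct xs"
  shows "card {i. i < length xs \<and> P (xs ! i)} = card {x \<in> set xs. P x}"
proof -
  have "{x \<in> set xs. P x} = (!) xs ` {i. i < length xs \<and> P (xs ! i)}"
    by (auto simp: in_set_conv_nth)
  moreover have "inj_on ((!) xs) {i. i < length xs \<and> P (xs ! i)}"
    using assms by (intro inj_on_nth) auto
  ultimately show ?thesis
    by (simp add: card_image)
qed

locale trace_code_setting = odd_degree_trace T p k
  for T :: "'q :: finite_field \<Rightarrow> 'q gfp" and p k :: nat +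
  fixes ds :: "'q list"
  assumes D_eq: "{y. y \<noteq> 0 \<and> T (y ^ 2) = 0} = {of_gfp a * b | a b. a \<noteq> 0 \<and> b \<in> set ds}"
    and reps: "b \<in> set ds \<Longrightarrow> c \<in> set ds \<Longrightarrow> b \<noteq> c \<Longrightarrow> b / c \<notin> {of_gfp a | a. a \<noteq> 0}"
    and distinct_ds: "distinct ds"
begin

definition codeword :: "'q \<Rightarrow> 'q gfp vec" where
  "codeword x = vec_of_list (map (\<lambda>d. T (x * d)) ds)"

text \<open>Every scaling orbit of nonzero isotropic vectors has \<open>p - 1\<close> elements and
  exactly one representative. A constant \<open>R\<close> gives the length of the code,
  \<open>T (x * y) \<noteq> 0\<close> its weights.\<close>

lemma card_representatives:
  assumes "\<And>a y. a \<noteq> 0 \<Longrightarrow> R (of_gfp a * y) \<longleftrightarrow> R y"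
  shows "(p - 1) * card {d \<in> set ds. R d} = card {y. y \<noteq> 0 \<and> T (y ^ 2) = 0 \<and> R y}"
proof -
  let ?A = "(UNIV - {0 :: 'q gfp}) \<times> {d \<in> set ds. R d}"
  have ds0: "d \<noteq> 0" if d: "d \<in> set ds" for d
  proof -
    have "of_gfp 1 * d \<in> {of_gfp a * b | a b. a \<noteq> 0 \<and> b \<in> set ds}"
      using d one_neq_zero by blast
    then show ?thesis
      unfolding D_eq[symmetric] by (simp add: of_gfp_1)
  qed
  have "a = b \<and> d = c"
    if *: "a \<noteq> 0" "b \<noteq> 0" "d \<in> set ds" "c \<in> set ds" "of_gfp a * d = of_gfp b * c"
    for a b :: "'q gfp" and c d
  proof -
    have "d / c = of_gfp (b / a)"
      using * ds0 by (simp add: of_gfp_divide field_simps)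
    moreover have "b / a \<noteq> 0"
      using * by simp
    ultimately have "d / c \<in> {of_gfp a | a. a \<noteq> 0}"
      by blast
    then have "d = c"
      using reps[OF *(3,4)] by blast
    then have "of_gfp a = (of_gfp b :: 'q)"
      using *(5) ds0[OF *(3)] by simp
    then show ?thesis
      using \<open>d = c\<close> injD[OF inj_of_gfp] by blast
  qed
  then have "inj_on (\<lambda>(a, d). of_gfp a * d) ?A"
    by (auto simp: inj_on_def)
  moreover have "(\<lambda>(a, d). of_gfp a * d) ` ?A = {y. y \<noteq> 0 \<and> T (y ^ 2) = 0 \<and> R y}"
  proof (rule Set.set_eqI)
    fix y
    have "y \<in> (\<lambda>(a, d). of_gfp a * d) ` ?A
        \<longleftrightarrow> (\<exists>a d. y = of_gfp a * d \<and> a \<noteq> 0 \<and> d \<in> set ds \<and> R d)"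
      by auto
    also have "\<dots> \<longleftrightarrow> y \<in> {of_gfp a * b | a b. a \<noteq> 0 \<and> b \<in> set ds} \<and> R y"
      using assms by blast
    also have "\<dots> \<longleftrightarrow> y \<in> {y. y \<noteq> 0 \<and> T (y ^ 2) = 0 \<and> R y}"
      unfolding D_eq[symmetric] by simp
    finally show "y \<in> (\<lambda>(a, d). of_gfp a * d) ` ?A \<longleftrightarrow> y \<in> {y. y \<noteq> 0 \<and> T (y ^ 2) = 0 \<and> R y}" .
  qed
  ultimately have "card {y. y \<noteq> 0 \<and> T (y ^ 2) = 0 \<and> R y} = card ?A"
    using card_image[of "\<lambda>(a, d). of_gfp a * d" ?A] by (simp only:)
  then show ?thesis
    by (simp add: card_cartesian_product card_Diff_subset)
qed

lemma length_ds: "(p - 1) * length ds = p ^ (2 * k + 2) - 1"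
proof -
  have "{y. y \<noteq> 0 \<and> T (y ^ 2) = 0 \<and> True} = {y. T (y ^ 2) = 0} - {0}"
    by auto
  then have "(p - 1) * card (set ds) = N 0 - 1"
    using card_representatives[of "\<lambda>_. True"] by (simp add: N_def)
  then show ?thesis
    using distinct_card[OF distinct_ds] by (simp add: N_0)
qed

section \<open>Weights of the codewords\<close>

lemma hamming_weight_codeword: "(p - 1) * hamming_weight (codeword x) = W x"
proof -
  have "hamming_weight (codeword x) = card {i. i < length ds \<and> T (x * ds ! i) \<noteq> 0}"
    by (simp add: hamming_weight_def codeword_def vec_of_list_index cong: conj_cong)
  also have "\<dots> = card {d \<in> set ds. T (x * d) \<noteq> 0}"
    by (rule card_nth_eq_card_set[OF distinct_ds])
  also have "(p - 1) * \<dots> = card {y. y \<noteq> 0 \<and> T (y ^ 2) = 0 \<and> T (x * y) \<noteq> 0}"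
    by (rule card_representatives) (simp add: T_scale2)
  \<comment> \<open>The vector \<open>y = 0\<close> is already excluded by
    \<open>T (x * y) \<noteq> 0\<close>.\<close>
  also have "\<dots> = W x"
    unfolding W_def by (intro arg_cong[of _ _ card]) auto
  finally show ?thesis .
qed

lemma p_power_simps:
  "p ^ (2 * k + 2) = p * p ^ (2 * k + 1)" "p ^ (k + 1) = p * p ^ k"
  by simp_all

lemma hamming_weight_zero: "hamming_weight (codeword 0) = 0"
proof -
  have "(p - 1) * hamming_weight (codeword 0) = 0"
    unfolding hamming_weight_codeword by (simp add: W_def)
  then show ?thesis
    using p_gt_2 by simp
qed

lemma hamming_weight_isotropic:
  assumes "x \<noteq> 0" "T (x ^ 2) = 0"
  shows "hamming_weight (codeword x) = p ^ (2 * k + 1)"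
proof -
  have "p * ((p - 1) * hamming_weight (codeword x)) = (p - 1) * (p * p ^ (2 * k + 1))"
    unfolding hamming_weight_codeword W_isotropic[OF assms] p_power_simps ..
  then have "(p * (p - 1)) * hamming_weight (codeword x) = (p * (p - 1)) * p ^ (2 * k + 1)"
    by (simp only: ac_simps)
  then show ?thesis
    using p_gt_2 by (simp del: power_Suc)
qed

lemma hamming_weight_anisotropic:
  assumes "T (x ^ 2) \<noteq> 0"
  shows "p * hamming_weight (codeword x) + N (T (x ^ 2)) = 2 * p ^ (2 * k + 2)"
proof -
  have "(p - 1) * (p * hamming_weight (codeword x) + N (T (x ^ 2)))
      = p * ((p - 1) * hamming_weight (codeword x)) + (p - 1) * N (T (x ^ 2))"
    by (simp only: distrib_left mult.left_commute)
  also have "\<dots> = (p - 1) * (2 * p ^ (2 * k + 2))"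
    unfolding hamming_weight_codeword W_anisotropic[OF refl assms] by simp
  finally show ?thesis
    using p_gt_2 by simp
qed

lemma hamming_weight_plus:
  assumes "T (x ^ 2) \<in> plus_values"
  shows "hamming_weight (codeword x) = p ^ (2 * k + 1) - p ^ k"
proof -
  have "p * hamming_weight (codeword x) + (p * p ^ (2 * k + 1) + p * p ^ k) = 2 * (p * p ^ (2 * k + 1))"
    using hamming_weight_anisotropic[of x] assms unfolding plus_values_def p_power_simps by simp
  then have "p * (hamming_weight (codeword x) + p ^ k) = p * p ^ (2 * k + 1)"
    unfolding distrib_left by linarith
  then have "hamming_weight (codeword x) + p ^ k = p ^ (2 * k + 1)"
    using p_gt_2 by (simp del: power_Suc)
  then show ?thesis
    by simp
qed

lemma hamming_weight_minus:
  assumes "T (x ^ 2) \<in> minus_values"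
  shows "hamming_weight (codeword x) = p ^ (2 * k + 1) + p ^ k"
proof -
  have "N (T (x ^ 2)) = p * p ^ (2 * k + 1) - p * p ^ k" "p * p ^ k < p * p ^ (2 * k + 1)"
    using assms p_power_less(2) unfolding minus_values_def p_power_simps by simp_all
  moreover have "p * hamming_weight (codeword x) + N (T (x ^ 2)) = 2 * (p * p ^ (2 * k + 1))"
    using hamming_weight_anisotropic[of x] assms unfolding minus_values_def p_power_simps by simp
  ultimately have "p * hamming_weight (codeword x) = p * (p ^ (2 * k + 1) + p ^ k)"
    unfolding distrib_left by linarith
  then show ?thesis
    using p_gt_2 by (simp del: power_Suc)
qed

text \<open>Separates the four weights, so that the weight of a codeword determines the class of
  \<open>x\<close>.\<close>

lemma weights_distinct:
  "p ^ (2 * k + 1) \<noteq> 0" "p ^ (2 * k + 1) - p ^ k \<noteq> 0" "p ^ (2 * k + 1) + p ^ k \<noteq> 0"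
  "p ^ (2 * k + 1) - p ^ k \<noteq> p ^ (2 * k + 1)" "p ^ (2 * k + 1) + p ^ k \<noteq> p ^ (2 * k + 1)"
  "p ^ (2 * k + 1) - p ^ k \<noteq> p ^ (2 * k + 1) + p ^ k"
proof -
  have "0 < p ^ k"
    using p_gt_2 by simp
  note bounds = this p_power_less(1)
  show "p ^ (2 * k + 1) \<noteq> 0" "p ^ (2 * k + 1) - p ^ k \<noteq> 0" "p ^ (2 * k + 1) + p ^ k \<noteq> 0"
    "p ^ (2 * k + 1) - p ^ k \<noteq> p ^ (2 * k + 1)" "p ^ (2 * k + 1) + p ^ k \<noteq> p ^ (2 * k + 1)"
    "p ^ (2 * k + 1) - p ^ k \<noteq> p ^ (2 * k + 1) + p ^ k"
    using bounds by linarith+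
qed

text \<open>Each case records every membership together with the weight, so that the equivalences
  below follow by comparing weights.\<close>

lemma codeword_cases:
  obtains "x = 0" "T (x ^ 2) \<notin> plus_values" "T (x ^ 2) \<notin> minus_values"
    "hamming_weight (codeword x) = 0"
  | "x \<noteq> 0" "T (x ^ 2) = 0" "T (x ^ 2) \<notin> plus_values" "T (x ^ 2) \<notin> minus_values"
    "hamming_weight (codeword x) = p ^ (2 * k + 1)"
  | "x \<noteq> 0" "T (x ^ 2) \<noteq> 0" "T (x ^ 2) \<in> plus_values" "T (x ^ 2) \<notin> minus_values"
    "hamming_weight (codeword x) = p ^ (2 * k + 1) - p ^ k"
  | "x \<noteq> 0" "T (x ^ 2) \<noteq> 0" "T (x ^ 2) \<notin> plus_values" "T (x ^ 2) \<in> minus_values"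
    "hamming_weight (codeword x) = p ^ (2 * k + 1) + p ^ k"
proof -
  have no_0: "0 \<notin> plus_values" "0 \<notin> minus_values"
    by (simp_all add: plus_values_def minus_values_def)
  consider "x = 0" | "x \<noteq> 0" "T (x ^ 2) = 0" | "x \<noteq> 0" "T (x ^ 2) \<noteq> 0"
    by blast
  then show ?thesis
  proof cases
    case 1
    then show ?thesis
      using that(1) no_0 hamming_weight_zero by simp
  next
    case 2
    then show ?thesis
      using that(2) no_0 hamming_weight_isotropic[OF 2] by metis
  next
    case 3
    then show ?thesis
      using that(3,4) plus_minus_values_Un plus_minus_values_disjoint
        hamming_weight_plus[of x] hamming_weight_minus[of x] by blast
  qed
qed

lemma hamming_weight_eq_0_iff: "hamming_weight (codeword x) = 0 \<longleftrightarrow> x = 0"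
  by (cases x rule: codeword_cases) (metis weights_distinct)+

lemma hamming_weight_eq_middle_iff: "hamming_weight (codeword x) = p ^ (2 * k + 1) \<longleftrightarrow> x \<noteq> 0 \<and> T (x ^ 2) = 0"
  by (cases x rule: codeword_cases) (metis weights_distinct)+

lemma hamming_weight_eq_low_iff: "hamming_weight (codeword x) = p ^ (2 * k + 1) - p ^ k \<longleftrightarrow> T (x ^ 2) \<in> plus_values"
  by (cases x rule: codeword_cases) (metis weights_distinct)+

lemma hamming_weight_eq_high_iff: "hamming_weight (codeword x) = p ^ (2 * k + 1) + p ^ k \<longleftrightarrow> T (x ^ 2) \<in> minus_values"
  by (cases x rule: codeword_cases) (metis weights_distinct)+

section \<open>Linearity, injectivity and dimension\<close>

lemma dim_codeword [simp]: "dim_vec (codeword x) = length ds"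
  by (simp add: codeword_def)

lemma index_codeword [simp]: "i < length ds \<Longrightarrow> codeword x $ i = T (x * ds ! i)"
  by (simp add: codeword_def vec_of_list_index)

lemma codeword_carrier: "codeword x \<in> carrier_vec (length ds)"
  by (rule carrier_vecI) simp

lemma codeword_add: "codeword (x + y) = codeword x + codeword y"
  by (rule eq_vecI) (simp_all add: distrib_right T_add)

lemma codeword_scale: "codeword (of_gfp a * x) = a \<cdot>\<^sub>v codeword x"
  by (rule eq_vecI) (simp_all add: mult.assoc T_scale)

lemma codeword_0: "codeword 0 = 0\<^sub>v (length ds)"
  by (rule eq_vecI) simp_all

text \<open>The weight formulas show that only \<open>x = 0\<close> has a codeword of weight 0, so
  this additive map has trivial kernel.\<close>

lemma inj_codeword: "inj codeword"
proof (rule injI)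
  fix x y assume eq: "codeword x = codeword y"
  have "codeword (x - y) = codeword x + codeword (- y)"
    by (simp flip: codeword_add)
  also have "\<dots> = codeword y + codeword (- y)"
    by (simp only: eq)
  also have "\<dots> = codeword 0"
    by (simp flip: codeword_add)
  finally have "codeword (x - y) = codeword 0" .
  then show "x = y"
    by (metis hamming_weight_eq_0_iff right_minus_eq)
qed

text \<open>The dimension comes from counting: by injectivity there are
  \<open>p ^ (2 * k + 3)\<close> codewords over a field of \<open>p\<close> elements.\<close>

lemma linear_code_range_codeword: "linear_code (length ds) (2 * k + 3) (range codeword)"
proof -
  let ?V = "module_vec TYPE('q gfp) (length ds)"
  have sub: "VectorSpace.subspace class_ring (range codeword) ?V"
  proof (rule subspace.intro)
    show "vectorspace class_ring ?V"
      by (rule vec_vs)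
    then show "submodule class_ring (range codeword) ?V"
    proof (intro submodule.intro)
      show "\<And>v w. v \<in> range codeword \<Longrightarrow> w \<in> range codeword \<Longrightarrow> v \<oplus>\<^bsub>?V\<^esub> w \<in> range codeword"
        by (auto simp: module_vec_simps simp flip: codeword_add)
      show "\<And>c v. c \<in> carrier class_ring \<Longrightarrow> v \<in> range codeword \<Longrightarrow> c \<odot>\<^bsub>?V\<^esub> v \<in> range codeword"
        by (auto simp: module_vec_simps simp flip: codeword_scale)
      show "\<zero>\<^bsub>?V\<^esub> \<in> range codeword"
        by (simp add: module_vec_simps flip: codeword_0)
    qed (auto simp: module_vec_simps codeword_carrier vectorspace_def)
  qed
  interpret S: vectorspace class_ring "?V\<lparr>carrier := range codeword\<rparr>"
    using vectorspace.subspace_is_vs[OF vec_vs sub] .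
  have "p ^ S.dim = card (range codeword)"
    using S.card_carrier_eq_power_dim by simp
  also have "\<dots> = p ^ (2 * k + 3)"
    using card_image[OF inj_codeword] card_q by simp
  finally have "S.dim = 2 * k + 3"
    using p_gt_2 by (simp add: power_inject_exp)
  then show ?thesis
    using sub by (simp add: linear_code_def)
qed

section \<open>The weight distribution\<close>

lemma num_codewords_range: "num_codewords (range codeword) w = card {x. hamming_weight (codeword x) = w}"
proof -
  have "{c \<in> range codeword. hamming_weight c = w} = codeword ` {x. hamming_weight (codeword x) = w}"
    by auto
  then show ?thesis
    unfolding num_codewords_def using inj_codeword by (metis card_image inj_on_subset subset_UNIV)
qed

lemma num_codewords_zero: "num_codewords (range codeword) 0 = 1"
  by (simp add: num_codewords_range hamming_weight_eq_0_iff)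

lemma num_codewords_low:
  \<comment> \<open>The relation \<open>p * weight = 2 * r - N\<close> pairs the low weight with the
    large fibres. The factor 2 avoids halving \<open>p - 1\<close> in the naturals.\<close>
  "2 * num_codewords (range codeword) (p ^ (2 * k + 1) - p ^ k) = (p - 1) * (p ^ (2 * k + 2) + p ^ (k + 1))"
proof -
  have "num_codewords (range codeword) (p ^ (2 * k + 1) - p ^ k) = (\<Sum>a\<in>plus_values. N a)"
    unfolding num_codewords_range hamming_weight_eq_low_iff N_def by (rule sum_card_fibers_on[symmetric])
  also have "\<dots> = (\<Sum>a\<in>plus_values. p ^ (2 * k + 2) + p ^ (k + 1))"
    by (intro sum.cong) (auto simp: plus_values_def)
  finally show ?thesis
    unfolding card_plus_minus_values(1)[symmetric] sum_constant by (simp only: of_nat_id mult.assoc)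
qed

lemma num_codewords_middle: "num_codewords (range codeword) (p ^ (2 * k + 1)) = p ^ (2 * k + 2) - 1"
proof -
  have "{x. x \<noteq> 0 \<and> T (x ^ 2) = 0} = {x. T (x ^ 2) = 0} - {0}"
    by auto
  then have "card {x. x \<noteq> 0 \<and> T (x ^ 2) = 0} = N 0 - 1"
    by (simp add: N_def)
  then show ?thesis
    unfolding num_codewords_range hamming_weight_eq_middle_iff N_0 .
qed

lemma num_codewords_high:
  "2 * num_codewords (range codeword) (p ^ (2 * k + 1) + p ^ k) = (p - 1) * (p ^ (2 * k + 2) - p ^ (k + 1))"
proof -
  have "num_codewords (range codeword) (p ^ (2 * k + 1) + p ^ k) = (\<Sum>a\<in>minus_values. N a)"
    unfolding num_codewords_range hamming_weight_eq_high_iff N_def by (rule sum_card_fibers_on[symmetric])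
  also have "\<dots> = (\<Sum>a\<in>minus_values. p ^ (2 * k + 2) - p ^ (k + 1))"
    by (intro sum.cong) (auto simp: minus_values_def)
  finally show ?thesis
    unfolding card_plus_minus_values(2)[symmetric] sum_constant by (simp only: of_nat_id mult.assoc)
qed

lemma num_codewords_other:
  assumes "w \<notin> {0, p ^ (2 * k + 1) - p ^ k, p ^ (2 * k + 1), p ^ (2 * k + 1) + p ^ k}"
  shows "num_codewords (range codeword) w = 0"
proof -
  have "hamming_weight (codeword x) \<noteq> w" for x
    using assms by (cases x rule: codeword_cases) auto
  then show ?thesis
    by (simp add: num_codewords_range)
qed

end

section \<open>Transfer to the trace code of degree \<open>m\<close>\<close>

theorem corollary3:
  fixes p m :: nat
    and D Dbar :: "'q :: finite_field set"
    and ds :: "'q list"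
    and C :: "'q gfp vec set"
  assumes "prime p" and "odd p"
    and "m > 1" and "odd m"
    and "CARD('q) = p ^ m"
    and "D = {x. x \<noteq> 0 \<and> tr m (x ^ 2) = 0}"
    and "Dbar \<subseteq> D"
    and "D = {of_gfp a * b | a b. a \<noteq> 0 \<and> b \<in> Dbar}"
    and "\<And>b c. b \<in> Dbar \<Longrightarrow> c \<in> Dbar \<Longrightarrow> b \<noteq> c \<Longrightarrow> b / c \<notin> {of_gfp a | a. a \<noteq> 0}"
    and "distinct ds" and "set ds = Dbar"
    and "C = trace_code m ds"
  shows "linear_code (length ds) m C
    \<and> real (length ds) = (real p ^ (m - 1) - 1) / (real p - 1)
    \<and> num_codewords C 0 = 1
    \<and> real (num_codewords C (p ^ (m - 2) - p ^ ((m - 3) div 2)))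
        = (real p - 1) / 2 * (real p ^ (m - 1) + real p ^ ((m - 1) div 2))
    \<and> real (num_codewords C (p ^ (m - 2))) = real p ^ (m - 1) - 1
    \<and> real (num_codewords C (p ^ (m - 2) + p ^ ((m - 3) div 2)))
        = (real p - 1) / 2 * (real p ^ (m - 1) - real p ^ ((m - 1) div 2))
    \<and> (\<forall>w. w \<notin> {0, p ^ (m - 2) - p ^ ((m - 3) div 2), p ^ (m - 2),
                    p ^ (m - 2) + p ^ ((m - 3) div 2)} \<longrightarrow> num_codewords C w = 0)"
proof -
  obtain k where m: "m = 2 * k + 3"
  proof -
    obtain j where "m = 2 * j + 1"
      using \<open>odd m\<close> by (metis oddE)
    \<comment> \<open>Here \<open>j\<close> is positive because \<open>m > 1\<close>, so
      \<open>j - 1\<close> is exact.\<close>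
    then have "m = 2 * (j - 1) + 3"
      using \<open>m > 1\<close> by simp
    then show ?thesis
      by (rule that)
  qed
  \<comment> \<open>The characteristic is a prime dividing \<open>p ^ m\<close>, hence equals
    \<open>p\<close>.\<close>
  have char: "CHAR('q) = p"
  proof -
    have "prime CHAR('q)"
      by (rule prime_CHAR_semidom) simp
    moreover have "CHAR('q) dvd p ^ m"
      using CHAR_dvd_CARD[where 'a = 'q] \<open>CARD('q) = p ^ m\<close> by simp
    ultimately show ?thesis
      using \<open>prime p\<close> by (metis prime_dvd_power primes_dvd_imp_eq)
  qed
  then have card: "CARD('q) = CHAR('q) ^ m"
    using \<open>CARD('q) = p ^ m\<close> by simp
  interpret trace_code_setting "tr m :: 'q \<Rightarrow> 'q gfp" p k ds
  proof
    show "\<exists>x :: 'q. tr m x \<noteq> 0"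
      using tr_nonzero[OF card] m by simp
    show "CARD('q) = p ^ (2 * k + 3)"
      using \<open>CARD('q) = p ^ m\<close> m by simp
    show "{y. y \<noteq> 0 \<and> tr m (y ^ 2) = 0} = {of_gfp a * b | a b. a \<noteq> 0 \<and> b \<in> set ds}"
      using assms(6, 8, 11) by simp
    show "b / c \<notin> {of_gfp a | a. a \<noteq> 0}" if "b \<in> set ds" "c \<in> set ds" "b \<noteq> c" for b c
      using assms(9, 11) that by simp
  qed (use tr_add[OF card] tr_scale[OF card] char assms in auto)
  have C: "C = range codeword"
    unfolding \<open>C = trace_code m ds\<close> trace_code_def codeword_def by auto
  have exps: "m - 1 = 2 * k + 2" "m - 2 = 2 * k + 1" "(m - 3) div 2 = k" "(2 * k + 2) div 2 = k + 1"
    using m by simp_all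
  have p1: "real (p - 1) = real p - 1"
    using p_gt_2 by simp
  have pos: "1 \<le> p ^ (2 * k + 2)"
    using p_gt_2 by simp
  have len: "real (length ds) = (real p ^ (2 * k + 2) - 1) / (real p - 1)"
  proof -
    have "(real p - 1) * real (length ds) = real p ^ (2 * k + 2) - 1"
      using arg_cong[OF length_ds, of real] p1 pos by (simp add: of_nat_diff)
    then show ?thesis
      using p_gt_2 by (simp add: field_simps)
  qed
  have low: "real (num_codewords C (p ^ (2 * k + 1) - p ^ k))
      = (real p - 1) / 2 * (real p ^ (2 * k + 2) + real p ^ (k + 1))"
    using arg_cong[OF num_codewords_low, of real] unfolding C of_nat_mult p1 of_nat_add of_nat_power by simp
  have high: "real (num_codewords C (p ^ (2 * k + 1) + p ^ k))
      = (real p - 1) / 2 * (real p ^ (2 * k + 2) - real p ^ (k + 1))"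
    using arg_cong[OF num_codewords_high, of real]
    unfolding C of_nat_mult p1 of_nat_diff[OF less_imp_le[OF p_power_less(2)]] of_nat_power by simp
  have middle: "real (num_codewords C (p ^ (2 * k + 1))) = real p ^ (2 * k + 2) - 1"
    unfolding C num_codewords_middle using pos by (simp add: of_nat_diff)
  have other: "\<forall>w. w \<notin> {0, p ^ (2 * k + 1) - p ^ k, p ^ (2 * k + 1), p ^ (2 * k + 1) + p ^ k}
      \<longrightarrow> num_codewords C w = 0"
    unfolding C by (intro allI impI num_codewords_other)
  have "linear_code (length ds) m C" "num_codewords C 0 = 1"
    unfolding C using linear_code_range_codeword num_codewords_zero m by simp_all
  then show ?thesis
    unfolding exps by (intro conjI len low middle high other)
qed

end
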